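(* Consider the equation $$u_{t}+\frac{1}{2}\,\frac{\sigma^{2}S^{2}u_{SS}\,u_S^2}{(u_S-c_1Su_{SS})^2}=0$$ for $u=u(S,t)$, let $c_1,\gamma\in\mathbb{R}\setminus\{0\}$, and put $$\kappa=\frac{\sigma^2}{2\gamma c_1^2},\qquad \beta=\frac{c_1+1}{c_1}.$$ With the invariant variables $z=\ln S-\gamma t$, $W(z)=u$ and the substitution $Y=W'$, and assuming that the denominator does not vanish, the equation reduces to the first-order ODE $$(Y')^2-(2\beta+\kappa)\,Y'Y+(\beta^2+\kappa)\,Y^2=0,$$ whose solution is $$Y(z)=d_1e^{k_{1,2}z},\qquad k_{1,2}=\beta+\frac{\kappa}{2}\pm\frac12\sqrt{\kappa\big(\kappa+4(\beta-1)\big)}.$$ The related solutions of the original equation take the form $$u(S,t)=d_1\,S^{k_{1,2}}e^{-\gamma k_{1,2}t}+d_2,\qquad d_1,d_2\in\mathbb{R}.$$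
   Context: Here $\sigma^2\in\mathbb{R}^+$ is a parameter, and $\gamma=\cot\phi$, where $\phi\in(0,\pi)$, $\cos\phi\neq0$; $z$ and $W$ are the invariants of the one-parameter group generated by $S\cos\phi\,\partial_S+\sin\phi\,\partial_t$. Primes denote differentiation with respect to $z$. It is assumed throughout that the denominator of the second term of the equation does not vanish, so all functions of the form $u(S,t)=d_1S^{\beta}e^{-\gamma\beta t}+d_2$ with $d_1,d_2\in\mathbb{R}$ (including constants) are excluded from consideration. The constants $d_1,d_2$ are arbitrary and are not the same constants from one formula to another.
   Formalization: When an exponent k is 0 (i.e. β²+κ=0), the stated form of u gives only the excluded constants; the related solutions are then u = d₁(ln S − γt) + d₂ instead. In u(S,t) the constant d₁ is taken nonzero, since constant u is excluded. *)

theory Defs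
  imports "HOL-Analysis.Analysis"
begin

text \<open>Functions of \<open>(S, t)\<close> take values in a real normed field, so that the same equation can be
  read for real-valued and for complex-valued \<open>u\<close>. All derivatives are with respect to real
  variables.\<close>

definition u_S :: "(real \<Rightarrow> real \<Rightarrow> 'a::real_normed_field) \<Rightarrow> real \<Rightarrow> real \<Rightarrow> 'a" where
  "u_S u S t = vector_derivative (\<lambda>s. u s t) (at S)"

definition u_SS :: "(real \<Rightarrow> real \<Rightarrow> 'a::real_normed_field) \<Rightarrow> real \<Rightarrow> real \<Rightarrow> 'a" where
  "u_SS u S t = vector_derivative (\<lambda>s. u_S u s t) (at S)"

definition u_t :: "(real \<Rightarrow> real \<Rightarrow> 'a::real_normed_field) \<Rightarrow> real \<Rightarrow> real \<Rightarrow> 'a" where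
  "u_t u S t = vector_derivative (\<lambda>\<tau>. u S \<tau>) (at t)"

definition region :: "(real \<times> real) set \<Rightarrow> bool" where
  "region D \<longleftrightarrow> open D \<and> connected D \<and> D \<noteq> {} \<and> (\<forall>(S, t)\<in>D. S > 0)"

text \<open>The derivatives occurring in the equation exist (this matters because
  \<^const>\<open>vector_derivative\<close> is total), and the denominator vanishes nowhere on \<open>D\<close>
  (this matters because division by zero yields zero).\<close>

definition admissible ::
  "real \<Rightarrow> (real \<times> real) set \<Rightarrow> (real \<Rightarrow> real \<Rightarrow> 'a::real_normed_field) \<Rightarrow> bool" where
  "admissible c\<^sub>1 D u \<longleftrightarrow> (\<forall>(S, t)\<in>D.
     (\<lambda>s. u s t) differentiable (at S) \<and>
     (\<lambda>s. u_S u s t) differentiable (at S) \<and>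
     (\<lambda>\<tau>. u S \<tau>) differentiable (at t) \<and>
     u_S u S t - of_real (c\<^sub>1 * S) * u_SS u S t \<noteq> 0)"

definition satisfies_pde ::
  "real \<Rightarrow> real \<Rightarrow> (real \<times> real) set \<Rightarrow> (real \<Rightarrow> real \<Rightarrow> 'a::real_normed_field) \<Rightarrow> bool" where
  "satisfies_pde \<sigma> c\<^sub>1 D u \<longleftrightarrow> (\<forall>(S, t)\<in>D.
     u_t u S t + 1/2 * (of_real (\<sigma>\<^sup>2 * S\<^sup>2) * u_SS u S t * (u_S u S t)\<^sup>2
                         / (u_S u S t - of_real (c\<^sub>1 * S) * u_SS u S t)\<^sup>2) = 0)"

definition solves_ode ::
  "real \<Rightarrow> real \<Rightarrow> real set \<Rightarrow> (real \<Rightarrow> 'a::real_normed_field) \<Rightarrow> bool" where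
  "solves_ode \<kappa> \<beta> J Y \<longleftrightarrow> (\<forall>z\<in>J. Y differentiable (at z) \<and>
     (vector_derivative Y (at z))\<^sup>2
       - of_real (2 * \<beta> + \<kappa>) * vector_derivative Y (at z) * Y z
       + of_real (\<beta>\<^sup>2 + \<kappa>) * (Y z)\<^sup>2 = 0)"

definition inv_z :: "real \<Rightarrow> real \<Rightarrow> real \<Rightarrow> real" where
  "inv_z \<gamma> S t = ln S - \<gamma> * t"

definition has_profile ::
  "real \<Rightarrow> (real \<times> real) set \<Rightarrow> (real \<Rightarrow> real \<Rightarrow> 'a) \<Rightarrow> (real \<Rightarrow> 'a) \<Rightarrow> bool" where
  "has_profile \<gamma> D u W \<longleftrightarrow> (\<forall>(S, t)\<in>D. u S t = W (inv_z \<gamma> S t))"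

text \<open>Invariance under the one-parameter group
  \<open>(S, t) \<mapsto> (S exp (\<epsilon> cos \<phi>), t + \<epsilon> sin \<phi>)\<close>, which is the flow of the generator
  \<open>S cos \<phi> \<partial>\<^sub>S + sin \<phi> \<partial>\<^sub>t\<close> and acts trivially on the dependent variable.\<close>

definition group_invariant :: "real \<Rightarrow> (real \<Rightarrow> real \<Rightarrow> 'a) \<Rightarrow> bool" where
  "group_invariant \<phi> u \<longleftrightarrow>
     (\<forall>\<epsilon> S t. S > 0 \<longrightarrow> u (S * exp (\<epsilon> * cos \<phi>)) (t + \<epsilon> * sin \<phi>) = u S t)"

definition half_plane :: "(real \<times> real) set" where
  "half_plane = {(S, t). S > 0}"

text \<open>The exponents are complex numbers (principal square root), since the radicand may be
  negative; the HOL square root on the reals would give \<open>- sqrt \<bar>x\<bar>\<close> for \<open>x < 0\<close>.\<close>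

definition k_plus :: "real \<Rightarrow> real \<Rightarrow> complex" where
  "k_plus \<kappa> \<beta> = of_real \<beta> + of_real \<kappa> / 2 + 1/2 * csqrt (of_real (\<kappa> * (\<kappa> + 4 * (\<beta> - 1))))"

definition k_minus :: "real \<Rightarrow> real \<Rightarrow> complex" where
  "k_minus \<kappa> \<beta> = of_real \<beta> + of_real \<kappa> / 2 - 1/2 * csqrt (of_real (\<kappa> * (\<kappa> + 4 * (\<beta> - 1))))"

definition Y_sol :: "complex \<Rightarrow> real \<Rightarrow> real \<Rightarrow> complex" where
  "Y_sol k d\<^sub>1 z = of_real d\<^sub>1 * exp (k * of_real z)"

definition u_sol :: "real \<Rightarrow> complex \<Rightarrow> real \<Rightarrow> real \<Rightarrow> real \<Rightarrow> real \<Rightarrow> complex" where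
  "u_sol \<gamma> k d\<^sub>1 d\<^sub>2 S t =
     of_real d\<^sub>1 * of_real S powr k * exp (- of_real \<gamma> * k * of_real t) + of_real d\<^sub>2"

end

theory Submission imports Defs begin

text \<open>On an invariant \<open>u = W (ln S - \<gamma> t)\<close> with \<open>Y = W'\<close> the equation becomes \<open>Y * P = 0\<close>, where
  \<open>P\<close> is the left-hand side of the reduced equation, and the denominator becomes
  \<open>c\<^sub>1 (\<beta> Y - Y') / S\<close>; so the factor \<open>Y\<close> has to be shown nonzero. Over the complex numbers
  \<open>P = (Y' - k\<^sub>1 Y) (Y' - k\<^sub>2 Y)\<close>, hence at each point \<open>Y'\<close> is \<open>k\<^sub>1 Y\<close> or \<open>k\<^sub>2 Y\<close>. A Gronwall
  argument shows that \<open>Y\<close> is identically or nowhere zero, and the Darboux property of the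
  logarithmic derivative \<open>Y'/Y\<close> excludes switching between the two exponents.\<close>

text \<open>Only the existence of the derivatives is given, so \<open>Y'\<close> may a priori be
  discontinuous; an intermediate value argument for it must rest on its being a derivative. Nor is
  \<open>W\<close> assumed smooth: its two derivatives are recovered from those of \<open>u\<close>
  in \<open>S\<close> along lines of constant \<open>t\<close>. The exponents may be nonreal while
  \<open>u\<close> is real. Then \<open>Y' = k * Y\<close> leaves only \<open>Y = 0\<close>, for
  which the denominator vanishes, so no real solution is lost by stating the formulas over the
  complex numbers. Conversely, an exponential built from a root \<open>k\<close> has denominator
  \<open>c\<^sub>1 (\<beta> - k) Y / S\<close>; it is nonzero because \<open>k = \<beta>\<close>
  would force \<open>\<kappa> (\<beta> - 1) = 0\<close>, whereas
  \<open>\<beta> - 1 = 1 / c\<^sub>1\<close>. The root \<open>k = 0\<close> occurs when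
  \<open>\<beta>\<^sup>2 + \<kappa> = 0\<close>; then \<open>Y\<close> is constant and
  \<open>u\<close> is logarithmic in \<open>S\<close>.\<close>

section \<open>Real functions with a pointwise constrained logarithmic derivative\<close>

text \<open>The Darboux property in the form used below. By Rolle \<open>f\<close> is injective, a
  continuous injection on an interval is monotone, and monotonicity fixes the weak sign of
  \<open>f'\<close>, which is strict because \<open>f'\<close> has no zero.\<close>

lemma deriv_nonzero_imp_constant_sign:
  fixes f f' :: "real \<Rightarrow> real"
  assumes J: "open J" "is_interval J"
    and der: "\<And>z. z \<in> J \<Longrightarrow> (f has_real_derivative f' z) (at z)"
    and nz: "\<And>z. z \<in> J \<Longrightarrow> f' z \<noteq> 0"
  shows "(\<forall>z\<in>J. f' z > 0) \<or> (\<forall>z\<in>J. f' z < 0)"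
proof -
  have cont: "continuous_on J f"
    by (meson der DERIV_isCont continuous_at_imp_continuous_on)
  have neq: "f x \<noteq> f y" if xy: "x \<in> J" "y \<in> J" "x < y" for x y
  proof
    assume eq: "f x = f y"
    have sub: "{x..y} \<subseteq> J"
      using J(2) xy unfolding is_interval_1 by fastforce
    obtain z where z: "x < z" "z < y" "(f has_real_derivative 0) (at z)"
      using Rolle[OF xy(3) eq] continuous_on_subset[OF cont sub] der sub
      by (metis atLeastAtMost_iff less_imp_le real_differentiable_def subset_iff)
    then have "z \<in> J" using sub by auto
    then show False using z(3) der nz DERIV_unique by blast
  qed
  then have "inj_on f J"
    by (intro linorder_inj_onI') auto
  then consider "strict_mono_on J f" | "strict_antimono_on J f"
    using injective_eq_monotone_map[OF J(2) cont] by blast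
  then show ?thesis
  proof cases
    case 1
    then have "mono_on J f" by (rule strict_mono_on_imp_mono_on)
    then have "f' z \<ge> 0" if "z \<in> J" for z
      using mono_on_imp_deriv_nonneg[OF _ der[OF that]] J(1) that by (simp add: interior_open)
    then show ?thesis using nz by force
  next
    case 2
    then have "mono_on J (\<lambda>z. - f z)"
      by (auto simp: monotone_on_def) (metis less_eq_real_def order.order_iff_strict)
    then have "- f' z \<ge> 0" if "z \<in> J" for z
      using mono_on_imp_deriv_nonneg[OF _ DERIV_minus[OF der[OF that]]] J(1) that
      by (simp add: interior_open)
    then show ?thesis using nz by force
  qed
qed

lemma gronwall_zero_right:
  fixes y y' :: "real \<Rightarrow> real"
  assumes "a \<le> b" and cont: "continuous_on {a..b} y"
    and der: "\<And>z. a < z \<Longrightarrow> z < b \<Longrightarrow> (y has_real_derivative y' z) (at z)"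
    and bound: "\<And>z. a < z \<Longrightarrow> z < b \<Longrightarrow> \<bar>y' z\<bar> \<le> C * \<bar>y z\<bar>"
    and "y a = 0"
  shows "y b = 0"
proof -
  \<comment> \<open>The bound gives \<open>2 * y * y' \<le> 2 * C * y\<^sup>2\<close>, and this
    weight turns that growth estimate into monotonicity of a nonnegative function starting at
    0.\<close>
  let ?g = "\<lambda>z. (y z)\<^sup>2 * exp (- 2 * C * z)"
  have "?g b \<le> ?g a"
  proof (rule DERIV_nonpos_imp_decreasing_open[OF \<open>a \<le> b\<close>])
    show "continuous_on {a..b} ?g" by (intro continuous_intros cont)
    fix z assume z: "a < z" "z < b"
    have "(?g has_real_derivative (2 * (y z * y' z - C * (y z)\<^sup>2)) * exp (- 2 * C * z)) (at z)"
      by (rule derivative_eq_intros der z refl | simp add: algebra_simps power2_eq_square)+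
    moreover have "y z * y' z \<le> \<bar>y z\<bar> * (C * \<bar>y z\<bar>)"
      by (metis abs_ge_self abs_ge_zero abs_mult bound mult_left_mono order_trans z)
    then have "y z * y' z - C * (y z)\<^sup>2 \<le> 0"
      by (simp add: power2_eq_square algebra_simps flip: abs_mult)
    then have "(2 * (y z * y' z - C * (y z)\<^sup>2)) * exp (- 2 * C * z) \<le> 0"
      by (simp add: mult_nonpos_nonneg)
    ultimately show "\<exists>d. (?g has_real_derivative d) (at z) \<and> d \<le> 0" by blast
  qed
  then show ?thesis using \<open>y a = 0\<close> by (simp add: mult_le_0_iff)
qed

lemma gronwall_zero:
  fixes y y' :: "real \<Rightarrow> real"
  assumes J: "is_interval J"
    and der: "\<And>z. z \<in> J \<Longrightarrow> (y has_real_derivative y' z) (at z)"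
    and bound: "\<And>z. z \<in> J \<Longrightarrow> \<bar>y' z\<bar> \<le> C * \<bar>y z\<bar>"
    and a: "a \<in> J" "y a = 0" and b: "b \<in> J"
  shows "y b = 0"
proof (cases "a \<le> b")
  case True
  have sub: "{a..b} \<subseteq> J"
    using J a b unfolding is_interval_1 by fastforce
  have "continuous_on {a..b} y"
    by (meson der sub subsetD DERIV_isCont continuous_at_imp_continuous_on)
  then show ?thesis
    using sub by (intro gronwall_zero_right[OF True, of y y' C] der bound a) auto
next
  case False
  have sub: "{b..a} \<subseteq> J"
    using J a b unfolding is_interval_1 by fastforce
  \<comment> \<open>Reflection reduces leftward propagation to rightward; the derivative changes
    sign, which the bound on its absolute value does not see.\<close>
  let ?x = "\<lambda>z. y (- z)"
  have dx: "(?x has_real_derivative - y' (- z)) (at z)" if "- z \<in> J" for z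
    using DERIV_mirror[of y "y' (- z)" z] der[OF that] by simp
  have "continuous_on {-a..-b} ?x"
  proof (intro continuous_at_imp_continuous_on ballI)
    fix z assume "z \<in> {-a..-b}"
    then have "- z \<in> J" using sub by force
    then show "isCont ?x z" using dx DERIV_isCont by blast
  qed
  moreover have "- z \<in> J" if "- a < z" "z < - b" for z
    using that sub by force
  ultimately have "?x (- b) = 0"
    using False a by (intro gronwall_zero_right[of "-a" "-b" ?x "\<lambda>z. - y' (- z)" C] dx)
       (auto intro: bound)
  then show ?thesis by simp
qed

lemma exp_solution:
  fixes y :: "real \<Rightarrow> real"
  assumes J: "is_interval J"
    and der: "\<And>z. z \<in> J \<Longrightarrow> (y has_real_derivative a * y z) (at z)"
  shows "\<exists>d. \<forall>z\<in>J. y z = d * exp (a * z)"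
proof -
  have "((\<lambda>z. y z * exp (- a * z)) has_real_derivative 0) (at z within J)" if "z \<in> J" for z
    by (rule has_field_derivative_at_within)
       (rule derivative_eq_intros der that refl | simp add: algebra_simps)+
  then obtain d where "\<forall>z\<in>J. y z * exp (- a * z) = d"
    using has_field_derivative_zero_constant[of J "\<lambda>z. y z * exp (- a * z)"]
      is_interval_convex[OF J] by blast
  then show ?thesis
    by (metis exp_minus exp_not_eq_zero minus_mult_left nonzero_eq_divide_eq divide_inverse)
qed

text \<open>The choice between \<open>a\<close> and \<open>b\<close> may vary with the point; a
  single \<open>k\<close> is obtained. It is not claimed to be \<open>a\<close> or \<open>b\<close>,
  and where this matters it is identified later by evaluating at one point.\<close>

lemma two_slopes_solution:
  fixes y y' :: "real \<Rightarrow> real"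
  assumes J: "open J" "is_interval J"
    and der: "\<And>z. z \<in> J \<Longrightarrow> (y has_real_derivative y' z) (at z)"
    and slopes: "\<And>z. z \<in> J \<Longrightarrow> y' z = a * y z \<or> y' z = b * y z"
  obtains k d where "\<And>z. z \<in> J \<Longrightarrow> y' z = k * y z" "\<And>z. z \<in> J \<Longrightarrow> y z = d * exp (k * z)"
proof -
  have "\<exists>k. \<forall>z\<in>J. y' z = k * y z"
  proof (cases "\<exists>z0\<in>J. y z0 = 0")
    case True
    have "\<bar>y' z\<bar> \<le> max \<bar>a\<bar> \<bar>b\<bar> * \<bar>y z\<bar>" if "z \<in> J" for z
      using slopes[OF that] by (auto simp: abs_mult mult_right_mono)
    then have "y z = 0" if "z \<in> J" for z
      using gronwall_zero[OF J(2) der] True that by blast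
    then show ?thesis using slopes by force
  next
    case False
    then have nz: "y z \<noteq> 0" if "z \<in> J" for z using that by blast
    show ?thesis
    proof (cases "a = b")
      case True then show ?thesis using slopes by blast
    next
      case ab: False
      \<comment> \<open>The logarithmic derivative, recentred at \<open>(a + b) / 2\<close>, takes only the values
        \<open>\<plusminus>(a - b) / 2\<close>, so by the Darboux property it cannot jump.\<close>
      let ?M = "\<lambda>z. ln ((y z)\<^sup>2) - (a + b) * z"
      \<comment> \<open>Squaring under the logarithm avoids a case split on the sign of
        \<open>y\<close> and doubles the quotient, hence the two values \<open>a - b\<close> and
        \<open>b - a\<close>.\<close>
      have dM: "(?M has_real_derivative 2 * (y' z / y z) - (a + b)) (at z)" if "z \<in> J" for z
        by (rule derivative_eq_intros der that refl | simp add: nz[OF that])+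
           (simp add: nz[OF that] power2_eq_square field_simps)
      have "y' z / y z = a \<or> y' z / y z = b" if "z \<in> J" for z
        using slopes[OF that] nz[OF that] by auto
      then have val: "2 * (y' z / y z) - (a + b) \<in> {a - b, b - a}" if "z \<in> J" for z
        using that by force
      have "(\<forall>z\<in>J. 2 * (y' z / y z) - (a + b) > 0) \<or> (\<forall>z\<in>J. 2 * (y' z / y z) - (a + b) < 0)"
        by (rule deriv_nonzero_imp_constant_sign[OF J dM]) (use val ab in force)+
      then have "\<exists>c. \<forall>z\<in>J. 2 * (y' z / y z) - (a + b) = c"
      proof
        assume "\<forall>z\<in>J. 2 * (y' z / y z) - (a + b) > 0"
        then show ?thesis using val by (intro exI[of _ "\<bar>a - b\<bar>"]) force
      next
        assume "\<forall>z\<in>J. 2 * (y' z / y z) - (a + b) < 0"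
        then show ?thesis using val by (intro exI[of _ "- \<bar>a - b\<bar>"]) force
      qed
      then obtain c where c: "\<forall>z\<in>J. 2 * (y' z / y z) - (a + b) = c" ..
      have "y' z = (c + a + b) / 2 * y z" if "z \<in> J" for z
        using c that nz[OF that] by (force simp: field_simps)
      then show ?thesis by blast
    qed
  qed
  then obtain k where k: "\<And>z. z \<in> J \<Longrightarrow> y' z = k * y z" by blast
  then obtain d where "\<forall>z\<in>J. y z = d * exp (k * z)"
    using exp_solution[OF J(2), of y k] der by metis
  with k that show ?thesis by blast
qed

text \<open>A zero with nonzero derivative is isolated, so the bound holds on an interval just to
  its right. Gronwall then makes \<open>y\<close> vanish there, contradicting isolation.\<close>

lemma nonzero_of_bounded_log_derivative:
  fixes y y' :: "real \<Rightarrow> real"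
  assumes J: "open J" "a \<in> J"
    and der: "\<And>z. z \<in> J \<Longrightarrow> (y has_real_derivative y' z) (at z)"
    and bound: "\<And>z. z \<in> J \<Longrightarrow> y z \<noteq> 0 \<Longrightarrow> \<bar>y' z\<bar> \<le> C * \<bar>y z\<bar>"
    and "y' a \<noteq> 0"
  shows "y a \<noteq> 0"
proof
  assume ya: "y a = 0"
  have "((\<lambda>z. (y z - y a) / (z - a)) \<longlongrightarrow> y' a) (at a)"
    using der[OF J(2)] by (simp add: has_field_derivative_iff)
  then have "eventually (\<lambda>z. (y z - y a) / (z - a) \<noteq> 0) (at a)"
    using tendsto_imp_eventually_ne[OF _ \<open>y' a \<noteq> 0\<close>] by blast
  then obtain e where e: "e > 0" "\<And>z. z \<noteq> a \<Longrightarrow> dist z a < e \<Longrightarrow> y z \<noteq> 0"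
    unfolding eventually_at using ya by force
  obtain r where r: "r > 0" "ball a r \<subseteq> J" using J open_contains_ball by blast
  \<comment> \<open>The radius \<open>r\<close> keeps the segment inside \<open>J\<close>, and
    \<open>e\<close> keeps it where \<open>a\<close> is the only zero.\<close>
  define b where "b = a + min e r / 2"
  have ab: "a < b" "b - a < e" "b - a < r"
    unfolding b_def using e(1) r(1) by (auto simp: min_def)
  have inJ: "z \<in> J" if "a \<le> z" "z \<le> b" for z
    using that ab r(2) by (auto simp: subset_iff dist_real_def)
  have "y b = 0"
  proof (rule gronwall_zero_right[of a b y y' C])
    show "continuous_on {a..b} y"
      by (meson der inJ atLeastAtMost_iff DERIV_isCont continuous_at_imp_continuous_on)
    fix z assume z: "a < z" "z < b"
    then have "y z \<noteq> 0" using e(2)[of z] ab by (auto simp: dist_real_def)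
    then show "\<bar>y' z\<bar> \<le> C * \<bar>y z\<bar>" using bound inJ z by simp
    show "(y has_real_derivative y' z) (at z)" using der inJ z by simp
  qed (use ab ya in auto)
  then show False using e(2)[of b] ab by (auto simp: dist_real_def)
qed


section \<open>The characteristic quadratic and passage between real and complex values\<close>

text \<open>Vieta's relations, stated for either order so that any given root comes with its
  partner. The square root enters only through its square, so its branch has no effect.\<close>

lemma quadratic_roots:
  assumes "k = k_plus \<kappa> \<beta> \<and> l = k_minus \<kappa> \<beta> \<or> k = k_minus \<kappa> \<beta> \<and> l = k_plus \<kappa> \<beta>"
  shows "k + l = of_real (2 * \<beta> + \<kappa>)" "k * l = of_real (\<beta>\<^sup>2 + \<kappa>)"
proof -
  define r where "r = csqrt (of_real (\<kappa> * (\<kappa> + 4 * (\<beta> - 1))))"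
  have r2: "r * r = of_real (\<kappa> * (\<kappa> + 4 * (\<beta> - 1)))"
    unfolding r_def by (metis power2_csqrt power2_eq_square)
  show "k + l = of_real (2 * \<beta> + \<kappa>)"
    using assms by (auto simp: k_plus_def k_minus_def)
  have kl: "k * l = (of_real \<beta> + of_real \<kappa> / 2)\<^sup>2 - r * r / 4"
    using assms unfolding k_plus_def k_minus_def r_def[symmetric]
    by (elim disjE conjE; simp only:) (simp_all add: power2_eq_square algebra_simps)
  show "k * l = of_real (\<beta>\<^sup>2 + \<kappa>)"
    unfolding kl r2 by (simp add: power2_eq_square field_simps)
qed

lemma ode_factorization:
  fixes y y' :: complex
  shows "y'\<^sup>2 - of_real (2 * \<beta> + \<kappa>) * y' * y + of_real (\<beta>\<^sup>2 + \<kappa>) * y\<^sup>2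
    = (y' - k_plus \<kappa> \<beta> * y) * (y' - k_minus \<kappa> \<beta> * y)"
proof -
  have eqs: "k_plus \<kappa> \<beta> + k_minus \<kappa> \<beta> = of_real (2 * \<beta> + \<kappa>)"
    "k_plus \<kappa> \<beta> * k_minus \<kappa> \<beta> = of_real (\<beta>\<^sup>2 + \<kappa>)"
    by (rule quadratic_roots; simp)+
  show ?thesis
    unfolding eqs[symmetric] by (simp add: power2_eq_square algebra_simps)
qed

text \<open>Embedding into the complex numbers makes the quadratic split even for negative
  discriminant. For nonreal \<open>k\<close> the right-hand equation forces
  \<open>y = y' = 0\<close>.\<close>

lemma real_ode_iff:
  fixes y y' :: real
  shows "y'\<^sup>2 - (2 * \<beta> + \<kappa>) * y' * y + (\<beta>\<^sup>2 + \<kappa>) * y\<^sup>2 = 0 \<longleftrightarrow>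
    (\<exists>k\<in>{k_plus \<kappa> \<beta>, k_minus \<kappa> \<beta>}. complex_of_real y' = k * of_real y)"
proof -
  have "y'\<^sup>2 - (2 * \<beta> + \<kappa>) * y' * y + (\<beta>\<^sup>2 + \<kappa>) * y\<^sup>2 = 0 \<longleftrightarrow>
    complex_of_real (y'\<^sup>2 - (2 * \<beta> + \<kappa>) * y' * y + (\<beta>\<^sup>2 + \<kappa>) * y\<^sup>2) = 0"
    by (simp only: of_real_eq_0_iff)
  also have "\<dots> \<longleftrightarrow> (of_real y' - k_plus \<kappa> \<beta> * of_real y) * (of_real y' - k_minus \<kappa> \<beta> * of_real y) = 0"
    unfolding ode_factorization[symmetric] by simp
  finally show ?thesis by auto
qed

text \<open>\<open>V\<close> is real on a neighbourhood, so it coincides there with the embedding of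
  its real part; uniqueness of the derivative makes \<open>v\<close> real. This carries complex
  exponentials back to real functions.\<close>

lemma has_vector_derivative_real_of_complex:
  assumes "open J" "z \<in> J" and eq: "\<And>z. z \<in> J \<Longrightarrow> complex_of_real (f z) = V z"
    and V: "(V has_vector_derivative v) (at z)"
  shows "(f has_vector_derivative Re v) (at z)" "complex_of_real (Re v) = v"
proof -
  have "((\<lambda>z. Re (V z)) has_vector_derivative Re v) (at z)"
    by (rule bounded_linear.has_vector_derivative[OF bounded_linear_Re V])
  moreover have "Re (V x) = f x" if "x \<in> J" for x
    using eq[OF that] by (metis Re_complex_of_real)
  ultimately show f: "(f has_vector_derivative Re v) (at z)"
    using assms(1,2) has_vector_derivative_transform_within_open by blast
  have "((\<lambda>z. complex_of_real (f z)) has_vector_derivative of_real (Re v)) (at z)"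
    by (rule bounded_linear.has_vector_derivative[OF bounded_linear_of_real f])
  then have "(V has_vector_derivative of_real (Re v)) (at z)"
    using assms(1,2) eq by (rule has_vector_derivative_transform_within_open)
  then show "complex_of_real (Re v) = v"
    using vector_derivative_at[OF V] vector_derivative_at by metis
qed

lemma has_vector_derivative_cexp:
  fixes k c :: complex
  shows "((\<lambda>z. c * exp (k * of_real z)) has_vector_derivative c * k * exp (k * of_real z)) (at z)"
proof -
  have "((\<lambda>w. c * exp (k * w)) has_field_derivative c * k * exp (k * of_real z)) (at (of_real z))"
    by (auto intro!: derivative_eq_intros)
  then show ?thesis by (rule has_vector_derivative_real_field)
qed

section \<open>Partial derivatives of a function of the invariant variable\<close>

lemma open_slices:
  fixes D :: "(real \<times> real) set"
  assumes "open D"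
  shows "open {s. (s, t) \<in> D}" "open {t. (s, t) \<in> D}"
proof -
  have "open ((\<lambda>s. (s, t)) -` D)" "open (Pair s -` D)"
    by (intro open_vimage assms continuous_intros)+
  then show "open {s. (s, t) \<in> D}" "open {t. (s, t) \<in> D}"
    by (simp_all add: vimage_def)
qed

lemma inv_z_derivs:
  assumes "S > 0"
  shows "((\<lambda>s. inv_z \<gamma> s t) has_vector_derivative 1 / S) (at S)"
    "((\<lambda>t. inv_z \<gamma> S t) has_vector_derivative - \<gamma>) (at t)"
  unfolding inv_z_def has_real_derivative_iff_has_vector_derivative[symmetric]
  using assms by (auto intro!: derivative_eq_intros)

text \<open>This is the set that the theorem calls \<open>J\<close>, the domain of the reduced
  equation.\<close>

definition z_range :: "real \<Rightarrow> (real \<times> real) set \<Rightarrow> real set" where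
  "z_range \<gamma> D = (\<lambda>(S, t). inv_z \<gamma> S t) ` D"

lemma z_rangeI: "(S, t) \<in> D \<Longrightarrow> inv_z \<gamma> S t \<in> z_range \<gamma> D"
  unfolding z_range_def by force

lemma z_rangeE:
  assumes "z \<in> z_range \<gamma> D"
  obtains S t where "(S, t) \<in> D" "z = inv_z \<gamma> S t"
  using assms unfolding z_range_def by auto

lemma inv_z_chain:
  assumes "S > 0" and W: "(W has_vector_derivative w) (at (inv_z \<gamma> S t))"
  shows "((\<lambda>s. W (inv_z \<gamma> s t)) has_vector_derivative (1 / S) *\<^sub>R w) (at S)"
    "((\<lambda>t. W (inv_z \<gamma> S t)) has_vector_derivative (- \<gamma>) *\<^sub>R w) (at t)"
  using vector_diff_chain_at[of "\<lambda>s. inv_z \<gamma> s t" "1 / S" S W w]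
    vector_diff_chain_at[of "\<lambda>t. inv_z \<gamma> S t" "- \<gamma>" t W w] inv_z_derivs[OF assms(1)] W
  by (simp_all add: o_def)

lemma profile_derivs:
  fixes u :: "real \<Rightarrow> real \<Rightarrow> 'a::real_normed_field"
  assumes D: "region D" and u: "has_profile \<gamma> D u W"
    and W: "\<And>z. z \<in> z_range \<gamma> D \<Longrightarrow> (W has_vector_derivative Y z) (at z)"
    and St: "(S, t) \<in> D"
  shows "((\<lambda>s. u s t) has_vector_derivative (1 / S) *\<^sub>R Y (inv_z \<gamma> S t)) (at S)"
    "((\<lambda>\<tau>. u S \<tau>) has_vector_derivative (- \<gamma>) *\<^sub>R Y (inv_z \<gamma> S t)) (at t)"
proof -
  have D: "open D" "S > 0" using D St by (auto simp: region_def)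
  have z: "inv_z \<gamma> S t \<in> z_range \<gamma> D" using St by (rule z_rangeI)
  show "((\<lambda>s. u s t) has_vector_derivative (1 / S) *\<^sub>R Y (inv_z \<gamma> S t)) (at S)"
    by (rule has_vector_derivative_transform_within_open
          [OF inv_z_chain(1)[OF D(2) W[OF z]] open_slices(1)[OF D(1), of t]])
       (use u St in \<open>auto simp: has_profile_def\<close>)
  show "((\<lambda>\<tau>. u S \<tau>) has_vector_derivative (- \<gamma>) *\<^sub>R Y (inv_z \<gamma> S t)) (at t)"
    by (rule has_vector_derivative_transform_within_open
          [OF inv_z_chain(2)[OF D(2) W[OF z]] open_slices(2)[OF D(1), of S]])
       (use u St in \<open>auto simp: has_profile_def\<close>)
qed

lemma profile_second_deriv:
  fixes u :: "real \<Rightarrow> real \<Rightarrow> 'a::real_normed_field"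
  assumes D: "region D" and u: "has_profile \<gamma> D u W"
    and W: "\<And>z. z \<in> z_range \<gamma> D \<Longrightarrow> (W has_vector_derivative Y z) (at z)"
    and Y: "\<And>z. z \<in> z_range \<gamma> D \<Longrightarrow> (Y has_vector_derivative Y' z) (at z)"
    and St: "(S, t) \<in> D"
  shows "((\<lambda>s. u_S u s t) has_vector_derivative
    (1 / S\<^sup>2) *\<^sub>R (Y' (inv_z \<gamma> S t) - Y (inv_z \<gamma> S t))) (at S)"
proof -
  have D': "open D" "S > 0" using D St by (auto simp: region_def)
  have z: "inv_z \<gamma> S t \<in> z_range \<gamma> D" using St by (rule z_rangeI)
  have "((\<lambda>s. (1 / s) *\<^sub>R Y (inv_z \<gamma> s t)) has_vector_derivative
      (1 / S) *\<^sub>R (1 / S) *\<^sub>R Y' (inv_z \<gamma> S t) + (- (1 / S\<^sup>2)) *\<^sub>R Y (inv_z \<gamma> S t)) (at S)"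
    by (rule has_vector_derivative_scaleR)
       (use D'(2) inv_z_chain(1)[OF D'(2) Y[OF z]] in
         \<open>auto intro!: derivative_eq_intros simp: power2_eq_square\<close>)
  then have "((\<lambda>s. (1 / s) *\<^sub>R Y (inv_z \<gamma> s t)) has_vector_derivative
      (1 / S\<^sup>2) *\<^sub>R (Y' (inv_z \<gamma> S t) - Y (inv_z \<gamma> S t))) (at S)"
    by (simp add: power2_eq_square scaleR_diff_right)
  \<comment> \<open>A second derivative needs \<open>u_S\<close> on a whole neighbourhood in the
    slice, so the first-order formula is applied at every nearby \<open>s\<close>.\<close>
  moreover have "(1 / s) *\<^sub>R Y (inv_z \<gamma> s t) = u_S u s t" if "s \<in> {s. (s, t) \<in> D}" for s
    unfolding u_S_def
    using vector_derivative_at[OF profile_derivs(1)[OF D u W]] that by simp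
  ultimately show ?thesis
    using has_vector_derivative_transform_within_open[OF _ open_slices(1)[OF D'(1), of t]] St
    by (metis (mono_tags, lifting) mem_Collect_eq)
qed

lemma profile_partials:
  fixes u :: "real \<Rightarrow> real \<Rightarrow> 'a::real_normed_field"
  assumes D: "region D" and u: "has_profile \<gamma> D u W"
    and W: "\<And>z. z \<in> z_range \<gamma> D \<Longrightarrow> (W has_vector_derivative Y z) (at z)"
    and Y: "\<And>z. z \<in> z_range \<gamma> D \<Longrightarrow> (Y has_vector_derivative Y' z) (at z)"
    and St: "(S, t) \<in> D"
  shows "u_S u S t = Y (inv_z \<gamma> S t) / of_real S"
    "u_SS u S t = (Y' (inv_z \<gamma> S t) - Y (inv_z \<gamma> S t)) / of_real (S\<^sup>2)"
    "u_t u S t = - of_real \<gamma> * Y (inv_z \<gamma> S t)"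
  unfolding u_S_def[of u S t] u_SS_def u_t_def
  using vector_derivative_at[OF profile_derivs(1)[OF D u W St]]
    vector_derivative_at[OF profile_derivs(2)[OF D u W St]]
    vector_derivative_at[OF profile_second_deriv[OF D u W Y St]]
  by (simp_all add: scaleR_conv_of_real divide_inverse mult.commute)

section \<open>The equation as algebra at one point\<close>

text \<open>Here \<open>y\<close> and \<open>y'\<close> stand for the values of \<open>Y\<close> and
  \<open>Y'\<close>. With \<open>e = \<beta> * y - y'\<close>, the denominator is
  \<open>c * e / S\<close>, and the equation times \<open>e\<^sup>2 / (- \<gamma>)\<close> reads
  \<open>y * (e\<^sup>2 - \<kappa> * (y' - y) * y) = 0\<close>; expanding \<open>e\<^sup>2\<close>
  gives the quadratic form.\<close>

lemma pde_pointwise: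
  fixes y y' :: "'a::real_normed_field"
  assumes "S > 0" "c \<noteq> 0" "\<gamma> \<noteq> 0" and \<kappa>: "\<kappa> = \<sigma>\<^sup>2 / (2 * \<gamma> * c\<^sup>2)" and \<beta>: "\<beta> = (c + 1) / c"
  shows "y / of_real S - of_real (c * S) * ((y' - y) / of_real (S\<^sup>2))
      = of_real (c / S) * (of_real \<beta> * y - y')" (is ?den)
    and "of_real \<beta> * y \<noteq> y' \<Longrightarrow>
     - of_real \<gamma> * y + 1/2 * (of_real (\<sigma>\<^sup>2 * S\<^sup>2) * ((y' - y) / of_real (S\<^sup>2)) * (y / of_real S)\<^sup>2
       / (y / of_real S - of_real (c * S) * ((y' - y) / of_real (S\<^sup>2)))\<^sup>2) = 0 \<longleftrightarrow>
     y * (y'\<^sup>2 - of_real (2 * \<beta> + \<kappa>) * y' * y + of_real (\<beta>\<^sup>2 + \<kappa>) * y\<^sup>2) = 0"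
proof -
  \<comment> \<open>Naming the embedded reals lets the field simplifier treat them as atoms of
    \<open>'a\<close>.\<close>
  define s g b C :: 'a where "s = of_real S" "g = of_real \<gamma>" "b = of_real \<beta>" "C = of_real c"
  note defs = this
  have nz: "s \<noteq> 0" "g \<noteq> 0" "C \<noteq> 0" using assms by (auto simp: defs)
  have \<sigma>: "\<sigma>\<^sup>2 = 2 * \<gamma> * c\<^sup>2 * \<kappa>" using assms by simp
  have "c * \<beta> = c + 1" using \<open>c \<noteq> 0\<close> \<beta> by simp
  then have Cb: "C * b = C + 1" unfolding defs by (metis of_real_1 of_real_add of_real_mult)
  have "y / s - C * s * ((y' - y) / s\<^sup>2) = ((C + 1) * y - C * y') / s"
    using nz by (simp add: power2_eq_square field_simps)
  also have "\<dots> = C / s * (b * y - y')"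
    unfolding Cb[symmetric] by (simp add: algebra_simps diff_divide_distrib)
  finally show den: ?den
    by (simp add: defs)
  assume ne: "of_real \<beta> * y \<noteq> y'"
  define e where "e = b * y - y'"
  have e: "e \<noteq> 0" using ne by (simp add: e_def defs)
  have "- g * y + 1/2 * (of_real (\<sigma>\<^sup>2 * S\<^sup>2) * ((y' - y) / of_real (S\<^sup>2)) * (y / s)\<^sup>2
       / (C / s * e)\<^sup>2) = - g / e\<^sup>2 * (y * (e\<^sup>2 - of_real \<kappa> * (y' - y) * y))"
    unfolding \<sigma> using nz e by (simp add: defs[symmetric] power2_eq_square field_simps)
  moreover have "e\<^sup>2 - of_real \<kappa> * (y' - y) * y
      = y'\<^sup>2 - of_real (2 * \<beta> + \<kappa>) * y' * y + of_real (\<beta>\<^sup>2 + \<kappa>) * y\<^sup>2"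
    by (simp add: e_def defs power2_eq_square algebra_simps)
  ultimately show "- of_real \<gamma> * y + 1/2 * (of_real (\<sigma>\<^sup>2 * S\<^sup>2) * ((y' - y) / of_real (S\<^sup>2)) * (y / of_real S)\<^sup>2
       / (y / of_real S - of_real (c * S) * ((y' - y) / of_real (S\<^sup>2)))\<^sup>2) = 0 \<longleftrightarrow>
     y * (y'\<^sup>2 - of_real (2 * \<beta> + \<kappa>) * y' * y + of_real (\<beta>\<^sup>2 + \<kappa>) * y\<^sup>2) = 0"
    unfolding den using nz e by (simp add: defs[symmetric] e_def[symmetric])
qed


section \<open>The domain and the regularity of the profile\<close>

text \<open>Openness comes from moving \<open>t\<close> alone, which shifts \<open>z\<close> since
  \<open>\<gamma> \<noteq> 0\<close>; the interval property comes from connectedness of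
  \<open>D\<close>.\<close>

lemma region_z_range:
  assumes D: "region D" and "\<gamma> \<noteq> 0"
  shows "open (z_range \<gamma> D)" "is_interval (z_range \<gamma> D)" "z_range \<gamma> D \<noteq> {}"
proof -
  have D': "open D" "connected D" "D \<noteq> {}" and pos: "\<And>S t. (S, t) \<in> D \<Longrightarrow> S > 0"
    using D by (auto simp: region_def)
  show "open (z_range \<gamma> D)"
  proof (subst open_subopen, intro ballI)
    fix z assume "z \<in> z_range \<gamma> D"
    then obtain S t where St: "(S, t) \<in> D" "z = inv_z \<gamma> S t" by (rule z_rangeE)
    \<comment> \<open>The point with the given \<open>S\<close> whose invariant variable equals
      \<open>x\<close>; at \<open>x = z\<close> it is \<open>(S, t)\<close>.\<close>
    let ?p = "\<lambda>x. (S, t - (x - z) / \<gamma>)"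
    have "open (?p -` D)" by (intro open_vimage D' continuous_intros) (use assms in auto)
    moreover have z: "inv_z \<gamma> S (t - (x - z) / \<gamma>) = x" for x
      using St \<open>\<gamma> \<noteq> 0\<close> by (simp add: inv_z_def field_simps)
    have "?p -` D \<subseteq> z_range \<gamma> D"
    proof
      fix x assume "x \<in> ?p -` D"
      then show "x \<in> z_range \<gamma> D" using z_rangeI[of S "t - (x - z) / \<gamma>" D \<gamma>] z by simp
    qed
    ultimately show "\<exists>T. open T \<and> z \<in> T \<and> T \<subseteq> z_range \<gamma> D"
      using St by (intro exI[of _ "?p -` D"]) auto
  qed
  have "continuous_on D (\<lambda>(S, t). inv_z \<gamma> S t)"
    unfolding inv_z_def split_def using pos by (intro continuous_intros) force+
  then show "is_interval (z_range \<gamma> D)"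
    using connected_continuous_image[OF _ D'(2)] is_interval_connected_1
    unfolding z_range_def by blast
  show "z_range \<gamma> D \<noteq> {}" using D' by (simp add: z_range_def)
qed

text \<open>With \<open>t\<close> frozen, \<open>S = exp (z + \<gamma> * t)\<close> inverts the
  invariant variable, so \<open>W\<close> is locally \<open>u\<close> composed with a smooth curve
  and inherits its two derivatives from those of \<open>u\<close> in \<open>S\<close>.\<close>

lemma profile_differentiable:
  fixes u :: "real \<Rightarrow> real \<Rightarrow> 'a::real_normed_field"
  assumes D: "region D" and u: "has_profile \<gamma> D u W" and adm: "admissible c D u"
    and z: "z \<in> z_range \<gamma> D"
  shows "(W has_vector_derivative vector_derivative W (at z)) (at z)"
    "((\<lambda>z. vector_derivative W (at z)) has_vector_derivative
      vector_derivative (\<lambda>z. vector_derivative W (at z)) (at z)) (at z)"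
proof -
  have D': "open D" and pos: "\<And>S t. (S, t) \<in> D \<Longrightarrow> S > 0"
    using D by (auto simp: region_def)
  \<comment> \<open>Stated for every point of the slice: the second derivative requires this formula
    for \<open>W'\<close> at all neighbouring points with the same \<open>t\<close>.\<close>
  have W: "(W has_vector_derivative exp (z + \<gamma> * t) *\<^sub>R u_S u (exp (z + \<gamma> * t)) t) (at z)"
    and T: "open {x. (exp (x + \<gamma> * t), t) \<in> D}"
    if "(exp (z + \<gamma> * t), t) \<in> D" for z t
  proof -
    have "open ((\<lambda>x. (exp (x + \<gamma> * t), t)) -` D)"
      by (intro open_vimage D' continuous_intros)
    then show T: "open {x. (exp (x + \<gamma> * t), t) \<in> D}" by (simp add: vimage_def)
    have "((\<lambda>s. u s t) has_vector_derivative u_S u (exp (z + \<gamma> * t)) t) (at (exp (z + \<gamma> * t)))"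
      using adm that unfolding admissible_def u_S_def by (force simp: vector_derivative_works)
    moreover have "((\<lambda>x. exp (x + \<gamma> * t)) has_vector_derivative exp (z + \<gamma> * t)) (at z)"
      unfolding has_real_derivative_iff_has_vector_derivative[symmetric]
      by (auto intro!: derivative_eq_intros)
    ultimately have "((\<lambda>x. u (exp (x + \<gamma> * t)) t) has_vector_derivative
        exp (z + \<gamma> * t) *\<^sub>R u_S u (exp (z + \<gamma> * t)) t) (at z)"
      using vector_diff_chain_at[of "\<lambda>x. exp (x + \<gamma> * t)" _ z "\<lambda>s. u s t"] by (simp add: o_def)
    then show "(W has_vector_derivative exp (z + \<gamma> * t) *\<^sub>R u_S u (exp (z + \<gamma> * t)) t) (at z)"
      by (rule has_vector_derivative_transform_within_open[OF _ T])
         (use that u in \<open>auto simp: has_profile_def inv_z_def\<close>)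
  qed
  obtain S t where St: "(S, t) \<in> D" "z = inv_z \<gamma> S t" using z by (rule z_rangeE)
  have S: "exp (z + \<gamma> * t) = S" using St pos by (simp add: inv_z_def)
  then have in_D: "(exp (z + \<gamma> * t), t) \<in> D" using St by simp
  show "(W has_vector_derivative vector_derivative W (at z)) (at z)"
    using W[OF in_D] vector_derivative_at by metis
  have "((\<lambda>s. u_S u s t) has_vector_derivative u_SS u S t) (at (exp (z + \<gamma> * t)))"
    using adm St S unfolding admissible_def u_SS_def by (force simp: vector_derivative_works)
  moreover have exp: "((\<lambda>x. exp (x + \<gamma> * t)) has_real_derivative exp (z + \<gamma> * t)) (at z)"
    by (auto intro!: derivative_eq_intros)
  ultimately have "((\<lambda>x. u_S u (exp (x + \<gamma> * t)) t) has_vector_derivative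
      exp (z + \<gamma> * t) *\<^sub>R u_SS u S t) (at z)"
    using vector_diff_chain_at[of "\<lambda>x. exp (x + \<gamma> * t)" _ z "\<lambda>s. u_S u s t"]
    by (simp add: o_def has_real_derivative_iff_has_vector_derivative)
  from has_vector_derivative_scaleR[OF exp this]
  obtain v where v: "((\<lambda>x. exp (x + \<gamma> * t) *\<^sub>R u_S u (exp (x + \<gamma> * t)) t)
      has_vector_derivative v) (at z)" by blast
  have "((\<lambda>z. vector_derivative W (at z)) has_vector_derivative v) (at z)"
    by (rule has_vector_derivative_transform_within_open[OF v T[OF in_D]])
       (use in_D vector_derivative_at[OF W] in auto)
  then show "((\<lambda>z. vector_derivative W (at z)) has_vector_derivative
      vector_derivative (\<lambda>z. vector_derivative W (at z)) (at z)) (at z)"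
    using vector_derivative_at by metis
qed

section \<open>Admissibility and the equation in terms of the profile\<close>

lemma profile_admissible_iff:
  fixes u :: "real \<Rightarrow> real \<Rightarrow> 'a::real_normed_field"
  assumes D: "region D" and u: "has_profile \<gamma> D u W"
    and W: "\<And>z. z \<in> z_range \<gamma> D \<Longrightarrow> (W has_vector_derivative Y z) (at z)"
    and Y: "\<And>z. z \<in> z_range \<gamma> D \<Longrightarrow> (Y has_vector_derivative Y' z) (at z)"
    and par: "c \<noteq> 0" "\<gamma> \<noteq> 0" "\<beta> = (c + 1) / c"
  shows "admissible c D u \<longleftrightarrow> (\<forall>z\<in>z_range \<gamma> D. of_real \<beta> * Y z \<noteq> Y' z)"
proof -
  have "((\<lambda>s. u s t) differentiable (at S) \<and> (\<lambda>s. u_S u s t) differentiable (at S) \<and>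
     (\<lambda>\<tau>. u S \<tau>) differentiable (at t) \<and> u_S u S t - of_real (c * S) * u_SS u S t \<noteq> 0)
    \<longleftrightarrow> of_real \<beta> * Y (inv_z \<gamma> S t) \<noteq> Y' (inv_z \<gamma> S t)" if St: "(S, t) \<in> D" for S t
  proof -
    have "S > 0" using D St by (auto simp: region_def)
    have "(\<lambda>s. u s t) differentiable (at S)" "(\<lambda>s. u_S u s t) differentiable (at S)"
      "(\<lambda>\<tau>. u S \<tau>) differentiable (at t)"
      using profile_derivs[OF D u W St] profile_second_deriv[OF D u W Y St] differentiableI_vector
      by blast+
    moreover have "u_S u S t - of_real (c * S) * u_SS u S t
        = of_real (c / S) * (of_real \<beta> * Y (inv_z \<gamma> S t) - Y' (inv_z \<gamma> S t))"
      by (simp only: profile_partials[OF D u W Y St]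
          pde_pointwise(1)[OF \<open>S > 0\<close> par(1,2) refl par(3)])
    ultimately show ?thesis using \<open>S > 0\<close> par(1) by simp
  qed
  then show ?thesis unfolding admissible_def z_range_def by fastforce
qed

text \<open>The factor \<open>Y z\<close> stays because the statement covers any real normed field,
  while its removal is an argument about real functions.\<close>

lemma profile_pde_iff:
  fixes u :: "real \<Rightarrow> real \<Rightarrow> 'a::real_normed_field"
  assumes D: "region D" and u: "has_profile \<gamma> D u W"
    and W: "\<And>z. z \<in> z_range \<gamma> D \<Longrightarrow> (W has_vector_derivative Y z) (at z)"
    and Y: "\<And>z. z \<in> z_range \<gamma> D \<Longrightarrow> (Y has_vector_derivative Y' z) (at z)"
    and par: "c \<noteq> 0" "\<gamma> \<noteq> 0" "\<kappa> = \<sigma>\<^sup>2 / (2 * \<gamma> * c\<^sup>2)" "\<beta> = (c + 1) / c"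
    and ne: "\<And>z. z \<in> z_range \<gamma> D \<Longrightarrow> of_real \<beta> * Y z \<noteq> Y' z"
  shows "satisfies_pde \<sigma> c D u \<longleftrightarrow> (\<forall>z\<in>z_range \<gamma> D. Y z * ((Y' z)\<^sup>2
    - of_real (2 * \<beta> + \<kappa>) * Y' z * Y z + of_real (\<beta>\<^sup>2 + \<kappa>) * (Y z)\<^sup>2) = 0)"
proof -
  have "u_t u S t + 1/2 * (of_real (\<sigma>\<^sup>2 * S\<^sup>2) * u_SS u S t * (u_S u S t)\<^sup>2
        / (u_S u S t - of_real (c * S) * u_SS u S t)\<^sup>2) = 0
    \<longleftrightarrow> Y z * ((Y' z)\<^sup>2 - of_real (2 * \<beta> + \<kappa>) * Y' z * Y z + of_real (\<beta>\<^sup>2 + \<kappa>) * (Y z)\<^sup>2) = 0"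
    if St: "(S, t) \<in> D" and z: "z = inv_z \<gamma> S t" for S t z
  proof -
    have "S > 0" using D St by (auto simp: region_def)
    have "of_real \<beta> * Y z \<noteq> Y' z" using ne z_rangeI[OF St] z by simp
    note pde_pointwise(2)[OF \<open>S > 0\<close> par this]
    then show ?thesis
      by (simp only: profile_partials[OF D u W Y St] z)
  qed
  then show ?thesis unfolding satisfies_pde_def z_range_def by fastforce
qed

text \<open>The differential equation only yields the reduced one multiplied by \<open>Y\<close>. A zero of \<open>Y\<close>
  is excluded because near it \<open>Y'/Y\<close> would be bounded, forcing \<open>Y' = 0\<close> there as well, which
  the nonvanishing denominator forbids.\<close>

lemma reduced_solution_nonzero:
  fixes Y Y' :: "real \<Rightarrow> real"
  assumes J: "open J" "z \<in> J"
    and Y: "\<And>z. z \<in> J \<Longrightarrow> (Y has_vector_derivative Y' z) (at z)"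
    and ne: "\<And>z. z \<in> J \<Longrightarrow> \<beta> * Y z \<noteq> Y' z"
    and eq: "\<And>z. z \<in> J \<Longrightarrow>
      Y z * ((Y' z)\<^sup>2 - (2 * \<beta> + \<kappa>) * Y' z * Y z + (\<beta>\<^sup>2 + \<kappa>) * (Y z)\<^sup>2) = 0"
  shows "Y z \<noteq> 0"
proof
  assume Yz: "Y z = 0"
  \<comment> \<open>Off the zeros of \<open>Y\<close>, the quotient \<open>Y' / Y\<close> is one of
    the two roots, so the larger modulus bounds it even if the roots are nonreal.\<close>
  let ?C = "max (cmod (k_plus \<kappa> \<beta>)) (cmod (k_minus \<kappa> \<beta>))"
  have "\<bar>Y' x\<bar> \<le> ?C * \<bar>Y x\<bar>" if x: "x \<in> J" "Y x \<noteq> 0" for x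
  proof -
    obtain k where k: "k \<in> {k_plus \<kappa> \<beta>, k_minus \<kappa> \<beta>}" "complex_of_real (Y' x) = k * of_real (Y x)"
      using eq[OF x(1)] x(2) real_ode_iff[of "Y' x" \<beta> \<kappa> "Y x"] by auto
    then have "\<bar>Y' x\<bar> = cmod k * \<bar>Y x\<bar>" by (metis norm_mult norm_of_real)
    then show ?thesis using k(1) by (auto intro: mult_right_mono)
  qed
  moreover have "Y' z \<noteq> 0" using ne[OF J(2)] Yz by auto
  ultimately have "Y z \<noteq> 0"
    using nonzero_of_bounded_log_derivative[OF J, of Y Y' ?C] Y
    by (simp add: has_real_derivative_iff_has_vector_derivative)
  with Yz show False by simp
qed

lemma reduction_to_ode:
  fixes u :: "real \<Rightarrow> real \<Rightarrow> real"
  assumes D: "region D" and u: "has_profile \<gamma> D u W" and adm: "admissible c D u"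
    and par: "c \<noteq> 0" "\<gamma> \<noteq> 0" "\<kappa> = \<sigma>\<^sup>2 / (2 * \<gamma> * c\<^sup>2)" "\<beta> = (c + 1) / c"
  shows "satisfies_pde \<sigma> c D u \<longleftrightarrow>
    solves_ode \<kappa> \<beta> (z_range \<gamma> D) (\<lambda>z. vector_derivative W (at z))"
proof -
  define Y where "Y = (\<lambda>z. vector_derivative W (at z))"
  define Y' where "Y' = (\<lambda>z. vector_derivative Y (at z))"
  have W: "(W has_vector_derivative Y z) (at z)"
    and Y: "(Y has_vector_derivative Y' z) (at z)" if "z \<in> z_range \<gamma> D" for z
    using profile_differentiable[OF D u adm that] by (simp_all add: Y_def Y'_def)
  have ne: "\<beta> * Y z \<noteq> Y' z" if "z \<in> z_range \<gamma> D" for z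
    using profile_admissible_iff[OF D u W Y par(1,2,4)] adm that by simp
  have pde: "satisfies_pde \<sigma> c D u \<longleftrightarrow> (\<forall>z\<in>z_range \<gamma> D. Y z * ((Y' z)\<^sup>2
    - (2 * \<beta> + \<kappa>) * Y' z * Y z + (\<beta>\<^sup>2 + \<kappa>) * (Y z)\<^sup>2) = 0)"
    using profile_pde_iff[OF D u W Y par] ne by simp
  have ode: "solves_ode \<kappa> \<beta> (z_range \<gamma> D) Y \<longleftrightarrow> (\<forall>z\<in>z_range \<gamma> D. (Y' z)\<^sup>2
    - (2 * \<beta> + \<kappa>) * Y' z * Y z + (\<beta>\<^sup>2 + \<kappa>) * (Y z)\<^sup>2 = 0)"
    unfolding solves_ode_def Y'_def using differentiableI_vector[OF Y] by simp
  \<comment> \<open>Needed for the forward direction only, where \<open>Y\<close> is cancelled; the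
    converse multiplies by it.\<close>
  have "Y z \<noteq> 0" if "satisfies_pde \<sigma> c D u" "z \<in> z_range \<gamma> D" for z
    using reduced_solution_nonzero[OF region_z_range(1)[OF D par(2)] that(2) Y ne, of \<kappa>]
      that(1) unfolding pde by blast
  then show ?thesis
    unfolding Y_def[symmetric] using pde ode by auto
qed

section \<open>Solutions of the reduced equation\<close>

text \<open>For real \<open>Y\<close> and \<open>Y'\<close>, the relation \<open>Y' = k * Y\<close>
  implies \<open>Y' = Re k * Y\<close>, so the real two-slope lemma applies whether or not the roots
  are real. The real exponent it returns is a root as soon as \<open>Y\<close> is nonzero at some
  point.\<close>

lemma solves_ode_iff_exp:
  fixes Y :: "real \<Rightarrow> real"
  assumes J: "open J" "is_interval J"
  shows "solves_ode \<kappa> \<beta> J Y \<longleftrightarrow>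
    (\<exists>k\<in>{k_plus \<kappa> \<beta>, k_minus \<kappa> \<beta>}. \<exists>d. \<forall>z\<in>J. complex_of_real (Y z) = Y_sol k d z)"
    (is "_ \<longleftrightarrow> (\<exists>k\<in>?K. _)")
proof
  assume ode: "solves_ode \<kappa> \<beta> J Y"
  define Y' where "Y' = (\<lambda>z. vector_derivative Y (at z))"
  have Y: "(Y has_real_derivative Y' z) (at z)" if "z \<in> J" for z
    using ode that unfolding solves_ode_def Y'_def
    by (simp add: has_real_derivative_iff_has_vector_derivative vector_derivative_works)
  have roots: "\<exists>k\<in>?K. complex_of_real (Y' z) = k * of_real (Y z)" if "z \<in> J" for z
    using ode that real_ode_iff[of "Y' z" \<beta> \<kappa> "Y z"] unfolding solves_ode_def Y'_def by simp
  have slopes: "Y' z = Re (k_plus \<kappa> \<beta>) * Y z \<or> Y' z = Re (k_minus \<kappa> \<beta>) * Y z" if z: "z \<in> J" for z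
  proof -
    obtain k where k: "k \<in> ?K" "complex_of_real (Y' z) = k * of_real (Y z)"
      using roots[OF z] by blast
    have "Re (complex_of_real (Y' z)) = Re k * Y z" unfolding k(2) by simp
    then show ?thesis using k(1) by auto
  qed
  obtain a d where a: "\<And>z. z \<in> J \<Longrightarrow> Y' z = a * Y z" and d: "\<And>z. z \<in> J \<Longrightarrow> Y z = d * exp (a * z)"
    using two_slopes_solution[OF J Y slopes] by blast
  show "\<exists>k\<in>?K. \<exists>d. \<forall>z\<in>J. complex_of_real (Y z) = Y_sol k d z"
  proof (cases "d = 0 \<or> J = {}")
    case True
    \<comment> \<open>The zero function has the required form with coefficient 0 for either root; it
      is all that remains when both are nonreal.\<close>
    then show ?thesis using d by (intro bexI[of _ "k_plus \<kappa> \<beta>"] exI[of _ 0]) (auto simp: Y_sol_def)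
  next
    case False
    then obtain z where z: "z \<in> J" by blast
    have "Y z \<noteq> 0" using False d[OF z] by simp
    then have "complex_of_real a \<in> ?K" using roots[OF z] a[OF z] by auto
    moreover have "complex_of_real (Y z) = Y_sol (of_real a) d z" if "z \<in> J" for z
      unfolding d[OF that] Y_sol_def by (simp flip: exp_of_real)
    ultimately show ?thesis by blast
  qed
next
  assume "\<exists>k\<in>?K. \<exists>d. \<forall>z\<in>J. complex_of_real (Y z) = Y_sol k d z"
  then obtain k d where k: "k \<in> ?K" and Y: "\<And>z. z \<in> J \<Longrightarrow> complex_of_real (Y z) = Y_sol k d z"
    by blast
  show "solves_ode \<kappa> \<beta> J Y"
    unfolding solves_ode_def
  proof
    fix z assume z: "z \<in> J"
    let ?v = "of_real d * k * exp (k * of_real z)"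
    have "(Y_sol k d has_vector_derivative ?v) (at z)"
      unfolding Y_sol_def by (rule has_vector_derivative_cexp)
    then have v: "(Y has_vector_derivative Re ?v) (at z)" "complex_of_real (Re ?v) = ?v"
      using has_vector_derivative_real_of_complex[of J z Y "Y_sol k d"] J(1) z Y by blast+
    have "complex_of_real (Re ?v) = k * of_real (Y z)"
      unfolding v(2) Y[OF z] Y_sol_def by simp
    then show "Y differentiable at z \<and> (vector_derivative Y (at z))\<^sup>2
        - of_real (2 * \<beta> + \<kappa>) * vector_derivative Y (at z) * Y z + of_real (\<beta>\<^sup>2 + \<kappa>) * (Y z)\<^sup>2 = 0"
      using differentiableI_vector[OF v(1)] k real_ode_iff[of "Re ?v" \<beta> \<kappa> "Y z"]
      unfolding vector_derivative_at[OF v(1)] by auto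
  qed
qed

text \<open>Keeps the denominator of an exponential profile away from zero. If
  \<open>k = \<beta>\<close>, the sum of the roots makes the other one
  \<open>\<beta> + \<kappa>\<close>, and their product then yields
  \<open>\<kappa> * (\<beta> - 1) = 0\<close>.\<close>

lemma root_neq:
  assumes "k \<in> {k_plus \<kappa> \<beta>, k_minus \<kappa> \<beta>}" "\<kappa> \<noteq> 0" "\<beta> \<noteq> 1"
  shows "k \<noteq> of_real \<beta>"
proof
  assume k: "k = of_real \<beta>"
  obtain l where "k + l = of_real (2 * \<beta> + \<kappa>)" and kl: "k * l = of_real (\<beta>\<^sup>2 + \<kappa>)"
    using assms(1) quadratic_roots by blast
  then have "l = of_real (\<beta> + \<kappa>)" using k by (simp add: algebra_simps)
  then have "complex_of_real (\<beta> * (\<beta> + \<kappa>)) = of_real (\<beta>\<^sup>2 + \<kappa>)"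
    using kl k by simp
  then have "\<beta> * (\<beta> + \<kappa>) = \<beta>\<^sup>2 + \<kappa>" by (simp only: of_real_eq_iff)
  then have "\<kappa> * (\<beta> - 1) = 0" by (simp add: power2_eq_square algebra_simps)
  then show False using assms by simp
qed

lemma u_sol_eq:
  assumes "S > 0"
  shows "u_sol \<gamma> k d\<^sub>1 d\<^sub>2 S t = of_real d\<^sub>1 * exp (k * of_real (inv_z \<gamma> S t)) + of_real d\<^sub>2"
  using assms by (simp add: u_sol_def powr_def Ln_of_real inv_z_def algebra_simps flip: exp_add)


section \<open>The real invariant solutions\<close>

lemma invariant_solution_imp_exp:
  fixes u :: "real \<Rightarrow> real \<Rightarrow> real"
  assumes D: "region D" and u: "has_profile \<gamma> D u W" and adm: "admissible c D u"
    and pde: "satisfies_pde \<sigma> c D u"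
    and par: "c \<noteq> 0" "\<gamma> \<noteq> 0" "\<kappa> = \<sigma>\<^sup>2 / (2 * \<gamma> * c\<^sup>2)" "\<beta> = (c + 1) / c"
  shows "\<exists>k\<in>{k_plus \<kappa> \<beta>, k_minus \<kappa> \<beta>}. \<exists>d\<^sub>1 d\<^sub>2. d\<^sub>1 \<noteq> 0 \<and>
    (k \<noteq> 0 \<and> (\<forall>(S, t)\<in>D. complex_of_real (u S t) = u_sol \<gamma> k d\<^sub>1 d\<^sub>2 S t) \<or>
     k = 0 \<and> (\<forall>(S, t)\<in>D. u S t = d\<^sub>1 * (ln S - \<gamma> * t) + d\<^sub>2))"
proof -
  define J where "J = z_range \<gamma> D"
  define Y where "Y = (\<lambda>z. vector_derivative W (at z))"
  define Y' where "Y' = (\<lambda>z. vector_derivative Y (at z))"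
  have J: "open J" "is_interval J" "J \<noteq> {}"
    unfolding J_def by (rule region_z_range[OF D par(2)])+
  have W: "(W has_vector_derivative Y z) (at z)"
    and Y: "(Y has_vector_derivative Y' z) (at z)" if "z \<in> J" for z
    using profile_differentiable[OF D u adm that[unfolded J_def]] by (simp_all add: Y_def Y'_def)
  have ne: "\<beta> * Y z \<noteq> Y' z" if "z \<in> J" for z
    using profile_admissible_iff[OF D u W Y par(1,2,4)] adm that by (simp add: J_def)
  have "solves_ode \<kappa> \<beta> J Y"
    using reduction_to_ode[OF D u adm par] pde by (simp add: J_def Y_def)
  then obtain k d where k: "k \<in> {k_plus \<kappa> \<beta>, k_minus \<kappa> \<beta>}"
    and d: "\<And>z. z \<in> J \<Longrightarrow> complex_of_real (Y z) = Y_sol k d z"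
    unfolding solves_ode_iff_exp[OF J(1,2)] by blast
  have Y': "complex_of_real (Y' z) = k * of_real (Y z)" if z: "z \<in> J" for z
  proof -
    let ?v = "of_real d * k * exp (k * of_real z)"
    have "(Y_sol k d has_vector_derivative ?v) (at z)"
      unfolding Y_sol_def by (rule has_vector_derivative_cexp)
    then have v: "(Y has_vector_derivative Re ?v) (at z)" "complex_of_real (Re ?v) = ?v"
      using has_vector_derivative_real_of_complex[of J z Y "Y_sol k d"] J(1) z d by blast+
    have "Y' z = Re ?v" using v(1) Y[OF z] vector_derivative_at by metis
    then show ?thesis using v(2) d[OF z] by (simp only: Y_sol_def mult_ac)
  qed
  obtain z where z: "z \<in> J" using J by blast
  have "Y z \<noteq> 0"
  proof
    assume "Y z = 0"
    then have "Y' z = 0" using Y'[OF z] by simp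
    then show False using ne[OF z] \<open>Y z = 0\<close> by simp
  qed
  then have "d \<noteq> 0" using d[OF z] by (auto simp: Y_sol_def)
  \<comment> \<open>A nonzero value of \<open>Y\<close> exhibits \<open>k\<close> as a quotient of
    reals, so nonreal roots drop out and the integration below is real.\<close>
  define r where "r = Y' z / Y z"
  have k_real: "k = of_real r" using Y'[OF z] \<open>Y z \<noteq> 0\<close> by (simp add: r_def)
  have Y_exp: "Y z = d * exp (r * z)" if "z \<in> J" for z
  proof -
    have "complex_of_real (Y z) = of_real (d * exp (r * z))"
      using d[OF that] unfolding Y_sol_def k_real by (simp flip: exp_of_real)
    then show ?thesis by (simp only: of_real_eq_iff)
  qed
  \<comment> \<open>The additive constant \<open>e\<close> becomes \<open>d\<^sub>2\<close>.\<close>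
  have primitive: "\<exists>e. \<forall>z\<in>J. W z = F z + e"
    if "\<And>z. z \<in> J \<Longrightarrow> (F has_real_derivative Y z) (at z)" for F
  proof -
    have "((\<lambda>z. W z - F z) has_real_derivative 0) (at z within J)" if "z \<in> J" for z
    proof (rule has_field_derivative_at_within)
      have "(W has_real_derivative Y z) (at z)"
        using W[OF that] by (simp add: has_real_derivative_iff_has_vector_derivative)
      from DERIV_diff[OF this \<open>\<And>z. z \<in> J \<Longrightarrow> (F has_real_derivative Y z) (at z)\<close>[OF that]]
      show "((\<lambda>z. W z - F z) has_real_derivative 0) (at z)" by simp
    qed
    then obtain e where "\<forall>z\<in>J. W z - F z = e"
      using has_field_derivative_zero_constant[OF is_interval_convex[OF J(2)]] by blast
    then show ?thesis by (intro exI[of _ e]) (auto simp: algebra_simps)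
  qed
  have uW: "u S t = W (inv_z \<gamma> S t)" "inv_z \<gamma> S t \<in> J" "S > 0" if "(S, t) \<in> D" for S t
    using u that D z_rangeI[OF that] by (auto simp: has_profile_def J_def region_def)
  show ?thesis
  proof (cases "r = 0")
    case True
    then have "((\<lambda>z. d * z) has_real_derivative Y z) (at z)" if "z \<in> J" for z
      using Y_exp[OF that] by (auto intro!: derivative_eq_intros)
    then obtain e where e: "\<forall>z\<in>J. W z = d * z + e" using primitive by blast
    have "u S t = d * (ln S - \<gamma> * t) + e" if "(S, t) \<in> D" for S t
      using uW[OF that] e by (simp add: inv_z_def)
    then show ?thesis
      using k k_real True \<open>d \<noteq> 0\<close> by (intro bexI[of _ k] exI[of _ d] exI[of _ e]) auto
  next
    case False
    \<comment> \<open>Integration divides by the exponent, so the coefficient in \<open>u\<close> is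
      \<open>d / r\<close>, not the \<open>d\<close> of \<open>Y\<close>.\<close>
    then have "((\<lambda>z. d / r * exp (r * z)) has_real_derivative Y z) (at z)" if "z \<in> J" for z
      using Y_exp[OF that] by (auto intro!: derivative_eq_intros)
    then obtain e where e: "\<forall>z\<in>J. W z = d / r * exp (r * z) + e" using primitive by blast
    have "complex_of_real (u S t) = u_sol \<gamma> k (d / r) e S t" if "(S, t) \<in> D" for S t
      using uW[OF that] e unfolding u_sol_eq[OF uW(3)[OF that]] k_real by (simp flip: exp_of_real)
    then show ?thesis
      using k k_real False \<open>d \<noteq> 0\<close>
      by (intro bexI[of _ k] exI[of _ "d / r"] exI[of _ e]) auto
  qed
qed

text \<open>The verification direction. It works over any real normed field, so it serves the real
  exponential and logarithmic profiles as well as the complex-valued solutions.\<close>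

lemma proportional_profile_solution:
  fixes u :: "real \<Rightarrow> real \<Rightarrow> 'a::real_normed_field"
  assumes D: "region D" and u: "has_profile \<gamma> D u W"
    and W: "\<And>z. z \<in> z_range \<gamma> D \<Longrightarrow> (W has_vector_derivative Y z) (at z)"
    and Y: "\<And>z. z \<in> z_range \<gamma> D \<Longrightarrow> (Y has_vector_derivative Y' z) (at z)"
    and par: "c \<noteq> 0" "\<gamma> \<noteq> 0" "\<kappa> = \<sigma>\<^sup>2 / (2 * \<gamma> * c\<^sup>2)" "\<beta> = (c + 1) / c"
    and ne: "\<And>z. z \<in> z_range \<gamma> D \<Longrightarrow> of_real \<beta> * Y z \<noteq> Y' z"
    and ode: "\<And>z. z \<in> z_range \<gamma> D \<Longrightarrow>
      (Y' z)\<^sup>2 - of_real (2 * \<beta> + \<kappa>) * Y' z * Y z + of_real (\<beta>\<^sup>2 + \<kappa>) * (Y z)\<^sup>2 = 0"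
  shows "admissible c D u \<and> satisfies_pde \<sigma> c D u"
  using profile_admissible_iff[OF D u W Y par(1,2,4)] profile_pde_iff[OF D u W Y par ne] ne ode
  by simp

text \<open>Instead of extracting that \<open>k\<close> is real, the proof uses that
  \<open>V\<close> takes only values of \<open>u\<close> on the range of \<open>z\<close>. It is
  therefore real on an open set, and so are its first two derivatives.\<close>

lemma exp_profile_solution:
  fixes u :: "real \<Rightarrow> real \<Rightarrow> real"
  assumes D: "region D"
    and par: "c \<noteq> 0" "\<gamma> \<noteq> 0" "\<kappa> = \<sigma>\<^sup>2 / (2 * \<gamma> * c\<^sup>2)" "\<beta> = (c + 1) / c" and "\<kappa> \<noteq> 0"
    and k: "k \<in> {k_plus \<kappa> \<beta>, k_minus \<kappa> \<beta>}" "k \<noteq> 0" and "d\<^sub>1 \<noteq> 0"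
    and u: "\<And>S t. (S, t) \<in> D \<Longrightarrow> complex_of_real (u S t) = u_sol \<gamma> k d\<^sub>1 d\<^sub>2 S t"
  shows "(\<exists>W. has_profile \<gamma> D u W) \<and> admissible c D u \<and> satisfies_pde \<sigma> c D u"
proof -
  define J where "J = z_range \<gamma> D"
  define V where "V = (\<lambda>z. of_real d\<^sub>1 * exp (k * of_real z) + complex_of_real d\<^sub>2)"
  define V1 where "V1 = (\<lambda>z::real. of_real d\<^sub>1 * k * exp (k * of_real z))"
  define V2 where "V2 = (\<lambda>z::real. of_real d\<^sub>1 * k * k * exp (k * of_real z))"
  have "open J" unfolding J_def by (rule region_z_range[OF D par(2)])
  have V: "(V has_vector_derivative V1 z) (at z)" for z
    unfolding V_def V1_def has_vector_derivative_add_const by (rule has_vector_derivative_cexp)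
  have V1: "(V1 has_vector_derivative V2 z) (at z)" for z
    unfolding V1_def V2_def by (rule has_vector_derivative_cexp)
  have uV: "complex_of_real (u S t) = V (inv_z \<gamma> S t)" if "(S, t) \<in> D" for S t
    using u[OF that] u_sol_eq[of S] D that by (auto simp: V_def region_def)
  then have prof: "has_profile \<gamma> D u (\<lambda>z. Re (V z))"
    unfolding has_profile_def by (auto simp flip: uV)
  have W: "complex_of_real (Re (V z)) = V z" if "z \<in> J" for z
    using that uV unfolding J_def by (metis z_rangeE Re_complex_of_real)
  have dW: "((\<lambda>z. Re (V z)) has_vector_derivative Re (V1 z)) (at z)"
    and Y: "complex_of_real (Re (V1 z)) = V1 z" if "z \<in> J" for z
    using has_vector_derivative_real_of_complex[of J z "\<lambda>z. Re (V z)" V] \<open>open J\<close> that W V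
    by blast+
  have dY: "((\<lambda>z. Re (V1 z)) has_vector_derivative Re (V2 z)) (at z)"
    and Y': "complex_of_real (Re (V2 z)) = V2 z" if "z \<in> J" for z
    using has_vector_derivative_real_of_complex[of J z "\<lambda>z. Re (V1 z)" V1] \<open>open J\<close> that Y V1
    by blast+
  have V21: "V2 z = k * V1 z" for z by (simp add: V1_def V2_def)
  have "\<beta> \<noteq> 1" using par by auto
  have ne: "\<beta> * Re (V1 z) \<noteq> Re (V2 z)" if "z \<in> J" for z
  proof
    assume "\<beta> * Re (V1 z) = Re (V2 z)"
    then have "complex_of_real (\<beta> * Re (V1 z)) = of_real (Re (V2 z))" by (simp only:)
    then have "of_real \<beta> * V1 z = k * V1 z" using Y[OF that] Y'[OF that] V21 by simp
    then show False
      using root_neq[OF k(1) \<open>\<kappa> \<noteq> 0\<close> \<open>\<beta> \<noteq> 1\<close>] k(2) \<open>d\<^sub>1 \<noteq> 0\<close> by (simp add: V1_def)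
  qed
  have ode: "(Re (V2 z))\<^sup>2 - (2 * \<beta> + \<kappa>) * Re (V2 z) * Re (V1 z) + (\<beta>\<^sup>2 + \<kappa>) * (Re (V1 z))\<^sup>2 = 0"
    if "z \<in> J" for z
    unfolding real_ode_iff Y[OF that] Y'[OF that] using V21 k by blast
  have "admissible c D u \<and> satisfies_pde \<sigma> c D u"
    by (rule proportional_profile_solution[OF D prof _ _ par,
          where Y = "\<lambda>z. Re (V1 z)" and Y' = "\<lambda>z. Re (V2 z)"])
       (use dW dY ne ode in \<open>simp_all add: J_def\<close>)
  with prof show ?thesis by blast
qed

lemma log_profile_solution:
  fixes u :: "real \<Rightarrow> real \<Rightarrow> real"
  assumes D: "region D"
    and par: "c \<noteq> 0" "\<gamma> \<noteq> 0" "\<kappa> = \<sigma>\<^sup>2 / (2 * \<gamma> * c\<^sup>2)" "\<beta> = (c + 1) / c" and "\<kappa> \<noteq> 0"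
    and k: "0 \<in> {k_plus \<kappa> \<beta>, k_minus \<kappa> \<beta>}" and "d\<^sub>1 \<noteq> 0"
    and u: "\<And>S t. (S, t) \<in> D \<Longrightarrow> u S t = d\<^sub>1 * (ln S - \<gamma> * t) + d\<^sub>2"
  shows "(\<exists>W. has_profile \<gamma> D u W) \<and> admissible c D u \<and> satisfies_pde \<sigma> c D u"
proof -
  have prof: "has_profile \<gamma> D u (\<lambda>z. d\<^sub>1 * z + d\<^sub>2)"
    using u by (auto simp: has_profile_def inv_z_def)
  have "\<beta> \<noteq> 1" using par by auto
  \<comment> \<open>Here the root is 0, so its being different from \<beta> says that \<beta> is
    nonzero; the denominator is a nonzero multiple of \<open>\<beta> * d\<^sub>1\<close>.\<close>
  then have "\<beta> \<noteq> 0" using root_neq[OF k \<open>\<kappa> \<noteq> 0\<close>] by auto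
  have ode: "0\<^sup>2 - (2 * \<beta> + \<kappa>) * 0 * d\<^sub>1 + (\<beta>\<^sup>2 + \<kappa>) * d\<^sub>1\<^sup>2 = 0"
    unfolding real_ode_iff using k by (intro bexI[of _ 0]) simp_all
  have "admissible c D u \<and> satisfies_pde \<sigma> c D u"
  proof (rule proportional_profile_solution[OF D prof _ _ par,
        where Y = "\<lambda>z. d\<^sub>1" and Y' = "\<lambda>z. 0"])
    show "((\<lambda>z. d\<^sub>1 * z + d\<^sub>2) has_vector_derivative d\<^sub>1) (at z)" for z
      unfolding has_real_derivative_iff_has_vector_derivative[symmetric]
      by (auto intro!: derivative_eq_intros)
  qed (use ode \<open>\<beta> \<noteq> 0\<close> \<open>d\<^sub>1 \<noteq> 0\<close> in simp_all)
  with prof show ?thesis by blast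
qed

section \<open>Complex-valued solutions on the half plane\<close>

lemma region_half_plane: "region half_plane"
proof -
  have eq: "half_plane = {0<..} \<times> UNIV" by (auto simp: half_plane_def)
  have "convex half_plane" unfolding eq by (intro convex_Times) auto
  then show ?thesis
    unfolding region_def using open_Times[of "{0::real<..}" "UNIV :: real set"] convex_connected
    by (auto simp: eq)
qed

lemma Y_sol_solves_ode:
  assumes k: "k \<in> {k_plus \<kappa> \<beta>, k_minus \<kappa> \<beta>}"
  shows "solves_ode \<kappa> \<beta> J (Y_sol k d)"
proof -
  have Y: "(Y_sol k d has_vector_derivative of_real d * k * exp (k * of_real z)) (at z)" for z
    unfolding Y_sol_def by (rule has_vector_derivative_cexp)
  show ?thesis
    unfolding solves_ode_def vector_derivative_at[OF Y] ode_factorization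
    using k differentiableI_vector[OF Y] by (auto simp: Y_sol_def)
qed

lemma u_sol_solution:
  assumes par: "c \<noteq> 0" "\<gamma> \<noteq> 0" "\<kappa> = \<sigma>\<^sup>2 / (2 * \<gamma> * c\<^sup>2)" "\<beta> = (c + 1) / c" and "\<kappa> \<noteq> 0"
    and k: "k \<in> {k_plus \<kappa> \<beta>, k_minus \<kappa> \<beta>}" "k \<noteq> 0" and "d\<^sub>1 \<noteq> 0"
  shows "admissible c half_plane (u_sol \<gamma> k d\<^sub>1 d\<^sub>2) \<and>
    satisfies_pde \<sigma> c half_plane (u_sol \<gamma> k d\<^sub>1 d\<^sub>2)"
proof (rule proportional_profile_solution[OF region_half_plane _ _ _ par])
  show "has_profile \<gamma> half_plane (u_sol \<gamma> k d\<^sub>1 d\<^sub>2)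
      (\<lambda>z. of_real d\<^sub>1 * exp (k * of_real z) + of_real d\<^sub>2)"
    by (auto simp: has_profile_def half_plane_def u_sol_eq)
  show "((\<lambda>z. of_real d\<^sub>1 * exp (k * of_real z) + of_real d\<^sub>2) has_vector_derivative
      of_real d\<^sub>1 * k * exp (k * of_real z)) (at z)" for z
    unfolding has_vector_derivative_add_const by (rule has_vector_derivative_cexp)
  show "((\<lambda>z. of_real d\<^sub>1 * k * exp (k * of_real z)) has_vector_derivative
      of_real d\<^sub>1 * k * k * exp (k * of_real z)) (at z)" for z
    by (rule has_vector_derivative_cexp)
  have "\<beta> \<noteq> 1" using par by auto
  then show "of_real \<beta> * (of_real d\<^sub>1 * k * exp (k * of_real z)) \<noteq>
      of_real d\<^sub>1 * k * k * exp (k * of_real z)" for z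
    using root_neq[OF k(1) \<open>\<kappa> \<noteq> 0\<close>] k(2) \<open>d\<^sub>1 \<noteq> 0\<close> by auto
  show "(of_real d\<^sub>1 * k * k * exp (k * of_real z))\<^sup>2
      - of_real (2 * \<beta> + \<kappa>) * (of_real d\<^sub>1 * k * k * exp (k * of_real z))
          * (of_real d\<^sub>1 * k * exp (k * of_real z))
      + of_real (\<beta>\<^sup>2 + \<kappa>) * (of_real d\<^sub>1 * k * exp (k * of_real z))\<^sup>2 = 0" for z
    unfolding ode_factorization using k(1) by auto
qed

section \<open>Invariance under the group\<close>

text \<open>Since \<open>sin \<phi> \<noteq> 0\<close>, every orbit meets the line
  \<open>t = 0\<close> exactly once, and there \<open>z = ln S\<close>. Hence
  \<open>W z = u (exp z) 0\<close> is the profile.\<close>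

lemma group_invariant_iff_profile:
  assumes \<phi>: "0 < \<phi>" "\<phi> < pi" and \<gamma>: "\<gamma> = cot \<phi>"
  shows "group_invariant \<phi> u \<longleftrightarrow> (\<exists>W. has_profile \<gamma> half_plane u W)"
proof
  have sin: "sin \<phi> \<noteq> 0" using sin_gt_zero[OF \<phi>] by simp
  assume inv: "group_invariant \<phi> u"
  have "u S t = u (exp (inv_z \<gamma> S t)) 0" if "S > 0" for S t
  proof -
    \<comment> \<open>The parameter \<open>- t / sin \<phi>\<close> moves the point along its orbit
      to time 0.\<close>
    have "u (S * exp (- t / sin \<phi> * cos \<phi>)) (t + - t / sin \<phi> * sin \<phi>) = u S t"
      using inv that unfolding group_invariant_def by blast
    moreover have "S * exp (- t / sin \<phi> * cos \<phi>) = exp (inv_z \<gamma> S t)"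
      using that by (simp add: inv_z_def \<gamma> cot_def exp_diff exp_minus field_simps)
    ultimately show ?thesis using sin by simp
  qed
  then have "has_profile \<gamma> half_plane u (\<lambda>z. u (exp z) 0)"
    unfolding has_profile_def half_plane_def by blast
  then show "\<exists>W. has_profile \<gamma> half_plane u W" by blast
next
  have sin: "sin \<phi> \<noteq> 0" using sin_gt_zero[OF \<phi>] by simp
  assume "\<exists>W. has_profile \<gamma> half_plane u W"
  then obtain W where W: "\<And>S t. S > 0 \<Longrightarrow> u S t = W (inv_z \<gamma> S t)"
    by (auto simp: has_profile_def half_plane_def)
  have "inv_z \<gamma> (S * exp (\<epsilon> * cos \<phi>)) (t + \<epsilon> * sin \<phi>) = inv_z \<gamma> S t" if "S > 0" for S t \<epsilon>
    using that sin by (simp add: inv_z_def \<gamma> cot_def ln_mult field_simps)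
  then show "group_invariant \<phi> u"
    unfolding group_invariant_def by (simp add: W)
qed

theorem mainTheorem4:
  fixes \<sigma> c\<^sub>1 \<gamma> \<kappa> \<beta> :: real and k\<^sub>1 k\<^sub>2 :: complex
  assumes "\<sigma>\<^sup>2 > 0" and "c\<^sub>1 \<noteq> 0" and "\<gamma> \<noteq> 0"
    and "\<kappa> = \<sigma>\<^sup>2 / (2 * \<gamma> * c\<^sub>1\<^sup>2)" and "\<beta> = (c\<^sub>1 + 1) / c\<^sub>1"
    and "k\<^sub>1 = k_plus \<kappa> \<beta>" and "k\<^sub>2 = k_minus \<kappa> \<beta>"
  shows
    \<comment> \<open>\<open>z\<close> and \<open>W\<close> are the invariants of the group\<close>
    "(\<forall>\<phi> (u :: real \<Rightarrow> real \<Rightarrow> real). 0 < \<phi> \<and> \<phi> < pi \<and> cos \<phi> \<noteq> 0 \<and> \<gamma> = cot \<phi> \<longrightarrow>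
        (group_invariant \<phi> u \<longleftrightarrow> (\<exists>W. has_profile \<gamma> half_plane u W)))
     \<and>
     \<comment> \<open>reduction to the first-order equation for \<open>Y = W'\<close>\<close>
     (\<forall>D (u :: real \<Rightarrow> real \<Rightarrow> real) W.
        region D \<and> has_profile \<gamma> D u W \<and> admissible c\<^sub>1 D u \<longrightarrow>
        (let J = (\<lambda>(S, t). inv_z \<gamma> S t) ` D in
          (\<forall>z\<in>J. W differentiable (at z)) \<and>
          (satisfies_pde \<sigma> c\<^sub>1 D u \<longleftrightarrow>
             solves_ode \<kappa> \<beta> J (\<lambda>z. vector_derivative W (at z)))))
     \<and>
     \<comment> \<open>the solutions of the first-order equation\<close>
     (\<forall>J (Y :: real \<Rightarrow> real). open J \<and> is_interval J \<longrightarrow>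
        (solves_ode \<kappa> \<beta> J Y \<longleftrightarrow>
          (\<exists>k\<in>{k\<^sub>1, k\<^sub>2}. \<exists>d\<^sub>1. \<forall>z\<in>J. complex_of_real (Y z) = Y_sol k d\<^sub>1 z)))
     \<and>
     \<comment> \<open>the invariant solutions of the original equation; an exponent \<open>k = 0\<close>
         integrates to a logarithm instead of a power\<close>
     (\<forall>D (u :: real \<Rightarrow> real \<Rightarrow> real). region D \<longrightarrow>
        ((\<exists>W. has_profile \<gamma> D u W) \<and> admissible c\<^sub>1 D u \<and> satisfies_pde \<sigma> c\<^sub>1 D u \<longleftrightarrow>
          (\<exists>k\<in>{k\<^sub>1, k\<^sub>2}. \<exists>d\<^sub>1 d\<^sub>2. d\<^sub>1 \<noteq> 0 \<and>
             (k \<noteq> 0 \<and> (\<forall>(S, t)\<in>D. complex_of_real (u S t) = u_sol \<gamma> k d\<^sub>1 d\<^sub>2 S t) \<or>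
              k = 0 \<and> (\<forall>(S, t)\<in>D. u S t = d\<^sub>1 * (ln S - \<gamma> * t) + d\<^sub>2)))))
     \<and>
     \<comment> \<open>for nonreal exponents the same formulas give complex-valued solutions\<close>
     (\<forall>k\<in>{k\<^sub>1, k\<^sub>2}. \<forall>d\<^sub>1 d\<^sub>2.
        solves_ode \<kappa> \<beta> UNIV (Y_sol k d\<^sub>1) \<and>
        (d\<^sub>1 \<noteq> 0 \<and> k \<noteq> 0 \<longrightarrow>
          admissible c\<^sub>1 half_plane (u_sol \<gamma> k d\<^sub>1 d\<^sub>2) \<and>
          satisfies_pde \<sigma> c\<^sub>1 half_plane (u_sol \<gamma> k d\<^sub>1 d\<^sub>2)))"
proof (intro conjI)
  have par: "c\<^sub>1 \<noteq> 0" "\<gamma> \<noteq> 0" "\<kappa> = \<sigma>\<^sup>2 / (2 * \<gamma> * c\<^sub>1\<^sup>2)" "\<beta> = (c\<^sub>1 + 1) / c\<^sub>1"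
    and \<kappa>: "\<kappa> \<noteq> 0" using assms by auto
  note ks = \<open>k\<^sub>1 = k_plus \<kappa> \<beta>\<close> \<open>k\<^sub>2 = k_minus \<kappa> \<beta>\<close>
  show "\<forall>\<phi> (u :: real \<Rightarrow> real \<Rightarrow> real). 0 < \<phi> \<and> \<phi> < pi \<and> cos \<phi> \<noteq> 0 \<and> \<gamma> = cot \<phi> \<longrightarrow>
        (group_invariant \<phi> u \<longleftrightarrow> (\<exists>W. has_profile \<gamma> half_plane u W))"
    using group_invariant_iff_profile by blast
  show "\<forall>D (u :: real \<Rightarrow> real \<Rightarrow> real) W.
        region D \<and> has_profile \<gamma> D u W \<and> admissible c\<^sub>1 D u \<longrightarrow>
        (let J = (\<lambda>(S, t). inv_z \<gamma> S t) ` D in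
          (\<forall>z\<in>J. W differentiable (at z)) \<and>
          (satisfies_pde \<sigma> c\<^sub>1 D u \<longleftrightarrow>
             solves_ode \<kappa> \<beta> J (\<lambda>z. vector_derivative W (at z))))"
    unfolding Let_def z_range_def[symmetric]
    using reduction_to_ode[OF _ _ _ par] profile_differentiable(1)[THEN differentiableI_vector]
    by blast
  show "\<forall>J (Y :: real \<Rightarrow> real). open J \<and> is_interval J \<longrightarrow>
        (solves_ode \<kappa> \<beta> J Y \<longleftrightarrow>
          (\<exists>k\<in>{k\<^sub>1, k\<^sub>2}. \<exists>d\<^sub>1. \<forall>z\<in>J. complex_of_real (Y z) = Y_sol k d\<^sub>1 z))"
    unfolding ks using solves_ode_iff_exp by blast
  show "\<forall>D (u :: real \<Rightarrow> real \<Rightarrow> real). region D \<longrightarrow>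
        ((\<exists>W. has_profile \<gamma> D u W) \<and> admissible c\<^sub>1 D u \<and> satisfies_pde \<sigma> c\<^sub>1 D u \<longleftrightarrow>
          (\<exists>k\<in>{k\<^sub>1, k\<^sub>2}. \<exists>d\<^sub>1 d\<^sub>2. d\<^sub>1 \<noteq> 0 \<and>
             (k \<noteq> 0 \<and> (\<forall>(S, t)\<in>D. complex_of_real (u S t) = u_sol \<gamma> k d\<^sub>1 d\<^sub>2 S t) \<or>
              k = 0 \<and> (\<forall>(S, t)\<in>D. u S t = d\<^sub>1 * (ln S - \<gamma> * t) + d\<^sub>2))))"
    unfolding ks
  proof (intro allI impI iffI)
    fix D and u :: "real \<Rightarrow> real \<Rightarrow> real"
    assume D: "region D"
    assume "(\<exists>W. has_profile \<gamma> D u W) \<and> admissible c\<^sub>1 D u \<and> satisfies_pde \<sigma> c\<^sub>1 D u"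
    then show "\<exists>k\<in>{k_plus \<kappa> \<beta>, k_minus \<kappa> \<beta>}. \<exists>d\<^sub>1 d\<^sub>2. d\<^sub>1 \<noteq> 0 \<and>
             (k \<noteq> 0 \<and> (\<forall>(S, t)\<in>D. complex_of_real (u S t) = u_sol \<gamma> k d\<^sub>1 d\<^sub>2 S t) \<or>
              k = 0 \<and> (\<forall>(S, t)\<in>D. u S t = d\<^sub>1 * (ln S - \<gamma> * t) + d\<^sub>2))"
      using invariant_solution_imp_exp[OF D _ _ _ par] by blast
  next
    fix D and u :: "real \<Rightarrow> real \<Rightarrow> real"
    assume D: "region D"
    assume "\<exists>k\<in>{k_plus \<kappa> \<beta>, k_minus \<kappa> \<beta>}. \<exists>d\<^sub>1 d\<^sub>2. d\<^sub>1 \<noteq> 0 \<and>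
             (k \<noteq> 0 \<and> (\<forall>(S, t)\<in>D. complex_of_real (u S t) = u_sol \<gamma> k d\<^sub>1 d\<^sub>2 S t) \<or>
              k = 0 \<and> (\<forall>(S, t)\<in>D. u S t = d\<^sub>1 * (ln S - \<gamma> * t) + d\<^sub>2))"
    then obtain k d\<^sub>1 d\<^sub>2 where k: "k \<in> {k_plus \<kappa> \<beta>, k_minus \<kappa> \<beta>}" and "d\<^sub>1 \<noteq> 0"
      and "k \<noteq> 0 \<and> (\<forall>(S, t)\<in>D. complex_of_real (u S t) = u_sol \<gamma> k d\<^sub>1 d\<^sub>2 S t) \<or>
           k = 0 \<and> (\<forall>(S, t)\<in>D. u S t = d\<^sub>1 * (ln S - \<gamma> * t) + d\<^sub>2)" by blast
    then consider
        "k \<noteq> 0" "\<And>S t. (S, t) \<in> D \<Longrightarrow> complex_of_real (u S t) = u_sol \<gamma> k d\<^sub>1 d\<^sub>2 S t"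
      | "k = 0" "\<And>S t. (S, t) \<in> D \<Longrightarrow> u S t = d\<^sub>1 * (ln S - \<gamma> * t) + d\<^sub>2" by blast
    then show "(\<exists>W. has_profile \<gamma> D u W) \<and> admissible c\<^sub>1 D u \<and> satisfies_pde \<sigma> c\<^sub>1 D u"
    proof cases
      case 1
      then show ?thesis by (intro exp_profile_solution[OF D par \<kappa> k _ \<open>d\<^sub>1 \<noteq> 0\<close>])
    next
      case 2
      then show ?thesis
        using k by (intro log_profile_solution[OF D par \<kappa> _ \<open>d\<^sub>1 \<noteq> 0\<close>]) simp_all
    qed
  qed
  show "\<forall>k\<in>{k\<^sub>1, k\<^sub>2}. \<forall>d\<^sub>1 d\<^sub>2.
        solves_ode \<kappa> \<beta> UNIV (Y_sol k d\<^sub>1) \<and>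
        (d\<^sub>1 \<noteq> 0 \<and> k \<noteq> 0 \<longrightarrow>
          admissible c\<^sub>1 half_plane (u_sol \<gamma> k d\<^sub>1 d\<^sub>2) \<and>
          satisfies_pde \<sigma> c\<^sub>1 half_plane (u_sol \<gamma> k d\<^sub>1 d\<^sub>2))"
    unfolding ks using Y_sol_solves_ode u_sol_solution[OF par \<kappa>] by blast
qed

end
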